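(* Let $n\ge 3$, let $P_n(R)$ be a regular $n$-gon in the Euclidean plane with vertices $A_1,\dots,A_n$ and circumradius $R>0$, and let $M$ be an arbitrary point of the plane. Then for every integer $m$ with $3\le m\le n-1$, $$S_n^{(2m)}=\left(S_n^{(2)}\right)^m+\sum_{k=1}^{\lfloor m/2\rfloor}\frac{1}{2^k}\binom{m}{2k}\binom{2k}{k}\left(S_n^{(4)}-\left(S_n^{(2)}\right)^2\right)^k\left(S_n^{(2)}\right)^{m-2k}.$$
   Context: The cyclic averages are $S_n^{(2m)}=\frac1n\sum_{i=1}^n d_i^{2m}$ with $d_i=|MA_i|$, for $1\le m\le n-1$. *)

theory Defs
  imports "HOL-Analysis.Analysis"
begin

text \<open>Polygons are given by their vertices \<open>A 1, \<dots>, A n\<close>; the values of \<open>A\<close> outside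
  \<open>{1..n}\<close> are irrelevant. The vertex following \<open>A n\<close> is \<open>A 1\<close>.\<close>

definition next_vertex :: "nat \<Rightarrow> nat \<Rightarrow> nat" where
  "next_vertex n i = (if i = n then 1 else Suc i)"

definition vertex_angle :: "real^2 \<Rightarrow> real^2 \<Rightarrow> real^2 \<Rightarrow> real" where
  "vertex_angle P Q S = arccos (((P - Q) \<bullet> (S - Q)) / (norm (P - Q) * norm (S - Q)))"

text \<open>The condition on edges excludes star polygons, and also degenerate polygons having three
  consecutive collinear vertices: the endpoints of an edge are extreme points of the hull.\<close>

definition convex_polygon :: "nat \<Rightarrow> (nat \<Rightarrow> real^2) \<Rightarrow> bool" where
  "convex_polygon n A \<longleftrightarrow>
     n \<ge> 3 \<and> inj_on A {1..n} \<and>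
     (\<forall>i\<in>{1..n}. closed_segment (A i) (A (next_vertex n i)) edge_of (convex hull (A ` {1..n})))"

definition equilateral_polygon :: "nat \<Rightarrow> (nat \<Rightarrow> real^2) \<Rightarrow> bool" where
  "equilateral_polygon n A \<longleftrightarrow>
     (\<exists>s. \<forall>i\<in>{1..n}. dist (A i) (A (next_vertex n i)) = s)"

definition equiangular_polygon :: "nat \<Rightarrow> (nat \<Rightarrow> real^2) \<Rightarrow> bool" where
  "equiangular_polygon n A \<longleftrightarrow>
     (\<exists>\<alpha>. \<forall>i\<in>{1..n}.
        vertex_angle (A i) (A (next_vertex n i)) (A (next_vertex n (next_vertex n i))) = \<alpha>)"

definition regular_polygon :: "nat \<Rightarrow> (nat \<Rightarrow> real^2) \<Rightarrow> bool" where
  "regular_polygon n A \<longleftrightarrow>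
     convex_polygon n A \<and> equilateral_polygon n A \<and> equiangular_polygon n A"

definition has_circumradius :: "nat \<Rightarrow> (nat \<Rightarrow> real^2) \<Rightarrow> real \<Rightarrow> bool" where
  "has_circumradius n A R \<longleftrightarrow> (\<exists>C. \<forall>i\<in>{1..n}. dist C (A i) = R)"

text \<open>The last argument is the exponent of the distances, so \<open>S\<^sub>n\<close> with superscript \<open>(2m)\<close>
  is \<open>cyclic_average n A M (2 * m)\<close>.\<close>

definition cyclic_average :: "nat \<Rightarrow> (nat \<Rightarrow> real^2) \<Rightarrow> real^2 \<Rightarrow> nat \<Rightarrow> real" where
  "cyclic_average n A M p = (1 / real n) * (\<Sum>i=1..n. dist M (A i) ^ p)"

end

theory Submission
  imports Defs
begin

text \<open>The vertices lie on a circle and consecutive ones are equidistant, so on the normalised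
  circle each step multiplies by \<open>w\<close> or by its conjugate; a change of direction
  would make two vertices coincide. Hence the vertices are \<open>C + R z w\<^sup>j\<close> for a primitive
  \<open>n\<close>-th root of unity \<open>w\<close>, and the squared distances have the form
  \<open>a + 2 Re (c w\<^sup>j)\<close>. When the \<open>m\<close>-th powers of these are expanded and averaged with
  \<open>m < n\<close>, only the terms free of \<open>w\<close> survive, which gives
  \<open>\<Sum>k. (m choose 2k) (2k choose k) |c|\<^sup>2\<^sup>k a\<^sup>m\<^sup>-\<^sup>2\<^sup>k\<close>. The cases \<open>m = 1\<close> and \<open>m = 2\<close> identify
  \<open>a\<close> with \<open>S\<^sup>(\<^sup>2\<^sup>)\<close> and \<open>2 |c|\<^sup>2\<close> with \<open>S\<^sup>(\<^sup>4\<^sup>) - (S\<^sup>(\<^sup>2\<^sup>))\<^sup>2\<close>.\<close>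

text \<open>Orthogonality of characters: the summand is the \<open>j\<close>-th power of
  \<open>v\<close>, which is \<open>w\<close> to the power \<open>p - q\<close> and hence an
  \<open>n\<close>-th root of unity. For \<open>p \<noteq> q\<close> it differs from 1 and the
  geometric sum vanishes.\<close>

lemma sum_mult_cnj_powers:
  fixes w :: complex
  assumes "norm w = 1" "w ^ n = 1" "inj_on (\<lambda>j. w ^ j) {..<n}" "p < n" "q < n"
  shows "(\<Sum>j<n. (w ^ j) ^ p * cnj (w ^ j) ^ q) = (if p = q then of_nat n else 0)"
proof -
  define v where "v = w ^ p * cnj w ^ q"
  have w1: "w * cnj w = 1"
    using assms(1) by (simp add: complex_norm_square[symmetric])
  have ww: "cnj w ^ k * w ^ k = 1" for k
    by (metis w1 mult.commute power_mult_distrib power_one)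
  have vj: "(w ^ j) ^ p * cnj (w ^ j) ^ q = v ^ j" for j
    by (simp add: v_def power_mult_distrib power_mult[symmetric] mult.commute)
  \<comment> \<open>This avoids a negative exponent: \<open>v = 1\<close> would give
    \<open>w ^ q = w ^ p\<close>, against injectivity below \<open>n\<close>.\<close>
  have "v * w ^ q = w ^ p"
    using ww[of q] by (simp add: v_def mult.assoc)
  show ?thesis
  proof (cases "p = q")
    case True
    then have "v = 1" using ww[of p] by (simp add: v_def mult.commute)
    then show ?thesis unfolding vj using True by simp
  next
    case False
    have "v \<noteq> 1"
      using \<open>v * w ^ q = w ^ p\<close> False assms(3-5) by (auto simp: inj_on_def)
    moreover have "v ^ n = (w ^ n) ^ p * cnj (w ^ n) ^ q"
      by (simp only: vj)
    then have "v ^ n = 1" using assms(2) by simp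
    ultimately show ?thesis unfolding vj using False
      by (simp add: geometric_sum)
  qed
qed

lemma sum_atMost_even:
  fixes g :: "nat \<Rightarrow> 'a::comm_monoid_add"
  shows "(\<Sum>l\<le>m. if even l then g (l div 2) else 0) = (\<Sum>k\<le>m div 2. g k)"
proof -
  have "(\<Sum>l\<le>m. if even l then g (l div 2) else 0) = (\<Sum>l\<in>{l. l \<le> m \<and> even l}. g (l div 2))"
    by (intro sum.mono_neutral_cong_right) auto
  also have "\<dots> = (\<Sum>k\<le>m div 2. g k)"
    by (rule sum.reindex_bij_witness[where j = "\<lambda>l. l div 2" and i = "\<lambda>k. 2 * k"]) auto
  finally show ?thesis .
qed

text \<open>Expand \<open>2 * Re u\<close> as \<open>u + cnj u\<close>. By orthogonality only the
  term with equally many factors \<open>u\<close> and \<open>cnj u\<close> survives; the bound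
  \<open>l < n\<close> keeps both exponents in the range where orthogonality holds.\<close>

lemma sum_powers_two_Re:
  fixes w c :: complex
  assumes "norm w = 1" "w ^ n = 1" "inj_on (\<lambda>j. w ^ j) {..<n}" "l < n"
  shows "(\<Sum>j<n. (2 * Re (c * w ^ j)) ^ l) =
    (if even l then real n * real (l choose (l div 2)) * ((norm c)\<^sup>2) ^ (l div 2) else 0)"
proof -
  have "complex_of_real (\<Sum>j<n. (2 * Re (c * w ^ j)) ^ l)
      = (\<Sum>j<n. (c * w ^ j + cnj (c * w ^ j)) ^ l)"
    by (simp only: complex_add_cnj of_real_sum of_real_power)
  also have "\<dots> = (\<Sum>j<n. \<Sum>p\<le>l. of_nat (l choose p) * c ^ p * cnj c ^ (l - p) *
                    ((w ^ j) ^ p * cnj (w ^ j) ^ (l - p)))"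
    by (simp add: binomial_ring power_mult_distrib mult_ac)
  also have "\<dots> = (\<Sum>p\<le>l. of_nat (l choose p) * c ^ p * cnj c ^ (l - p) *
                    (\<Sum>j<n. (w ^ j) ^ p * cnj (w ^ j) ^ (l - p)))"
    by (subst sum.swap) (simp only: sum_distrib_left)
  also have "\<dots> = (\<Sum>p\<le>l. if p = l - p then of_nat n * of_nat (l choose p) * (c * cnj c) ^ p else 0)"
    using assms(4)
    by (intro sum.cong refl, subst sum_mult_cnj_powers[OF assms(1-3)]) (auto simp: power_mult_distrib)
  also have "\<dots> = (\<Sum>p\<in>(if even l then {l div 2} else {}).
                    of_nat n * of_nat (l choose p) * (c * cnj c) ^ p)"
  proof -
    \<comment> \<open>The surviving index is the middle one, so the sum shrinks to a singleton for
      even \<open>l\<close> and to the empty set for odd \<open>l\<close>.\<close>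
    have "p = l - p \<longleftrightarrow> even l \<and> p = l div 2" if "p \<le> l" for p
      using that by presburger
    then show ?thesis
      by (intro sum.mono_neutral_cong_right) (auto split: if_splits)
  qed
  also have "\<dots> = complex_of_real (if even l
      then real n * real (l choose (l div 2)) * ((norm c)\<^sup>2) ^ (l div 2) else 0)"
    by (simp add: complex_norm_square[symmetric])
  finally show ?thesis
    by (simp only: of_real_eq_iff)
qed

lemma average_powers_add_two_Re:
  fixes w c :: complex and a :: real
  assumes "norm w = 1" "w ^ n = 1" "inj_on (\<lambda>j. w ^ j) {..<n}" "m < n"
  shows "(1 / real n) * (\<Sum>j<n. (a + 2 * Re (c * w ^ j)) ^ m) =
    (\<Sum>k\<le>m div 2. real (m choose (2 * k)) * real ((2 * k) choose k) *
        ((norm c)\<^sup>2) ^ k * a ^ (m - 2 * k))"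
proof -
  have "(\<Sum>j<n. (a + 2 * Re (c * w ^ j)) ^ m)
      = (\<Sum>j<n. (2 * Re (c * w ^ j) + a) ^ m)"
    by (simp add: add.commute)
  also have "\<dots> = (\<Sum>l\<le>m. real (m choose l) * a ^ (m - l) * (\<Sum>j<n. (2 * Re (c * w ^ j)) ^ l))"
    unfolding binomial_ring sum_distrib_left
    by (subst sum.swap) (simp add: mult_ac)
  \<comment> \<open>For even \<open>l\<close> the index is written \<open>2 * (l div 2)\<close>, so
    that the summand depends on \<open>l div 2\<close> alone, as \<open>sum_atMost_even\<close>
    requires.\<close>
  also have "\<dots> = (\<Sum>l\<le>m. if even l then real n * (real (m choose (2 * (l div 2))) *
      real ((2 * (l div 2)) choose (l div 2)) * ((norm c)\<^sup>2) ^ (l div 2) * a ^ (m - 2 * (l div 2))) else 0)"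
    using assms(4)
    by (intro sum.cong refl, subst sum_powers_two_Re[OF assms(1-3)]) auto
  also have "\<dots> = real n * (\<Sum>k\<le>m div 2. real (m choose (2 * k)) * real ((2 * k) choose k) *
        ((norm c)\<^sup>2) ^ k * a ^ (m - 2 * k))"
    by (subst sum_atMost_even) (simp add: sum_distrib_left)
  finally show ?thesis using assms(4) by simp
qed

text \<open>The quotient \<open>q j\<close> of consecutive points lies on the unit circle at
  distance \<open>s\<close> from 1, which fixes it up to conjugation. Passing to the conjugate would
  undo the previous step, which \<open>no_return\<close> forbids, so the quotient is
  constant.\<close>

lemma unit_circle_equidistant_power:
  fixes z :: "nat \<Rightarrow> complex"
  assumes unit: "\<And>j. norm (z j) = 1"
    and step: "\<And>j. norm (z (Suc j) - z j) = s"
    and no_return: "\<And>j. z (Suc (Suc j)) \<noteq> z j"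
  obtains w where "norm w = 1" "\<And>j. z j = z 0 * w ^ j"
proof
  define q where "q j = z (Suc j) * cnj (z j)" for j
  have zz: "z j * cnj (z j) = 1" for j
    using unit[of j] by (simp add: complex_norm_square[symmetric])
  have z_Suc: "z (Suc j) = q j * z j" for j
    unfolding q_def using zz[of j] by (simp add: mult.assoc mult.commute[of "cnj _"])
  have q_unit: "norm (q j) = 1" for j
    by (simp add: q_def norm_mult unit)
  have q_dist: "norm (q j - 1) = s" for j
  proof -
    have "z (Suc j) - z j = (q j - 1) * z j"
      by (simp add: z_Suc algebra_simps)
    then show ?thesis using step[of j] unit[of j] by (simp add: norm_mult)
  qed
  have sq: "(Re (q j))\<^sup>2 + (Im (q j))\<^sup>2 = 1" "(Re (q j) - 1)\<^sup>2 + (Im (q j))\<^sup>2 = s\<^sup>2" for j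
    using q_unit[of j] q_dist[of j] cmod_power2[of "q j"] cmod_power2[of "q j - 1"] by simp_all
  \<comment> \<open>Difference of the two equations in \<open>sq\<close>.\<close>
  have Re_q: "Re (q j) = 1 - s\<^sup>2 / 2" for j
    using sq[of j] by (simp add: power2_eq_square algebra_simps)
  have "q (Suc j) = q j" for j
  proof (rule ccontr)
    assume "q (Suc j) \<noteq> q j"
    moreover have "(Im (q (Suc j)))\<^sup>2 = (Im (q j))\<^sup>2"
      using sq(1)[of j] sq(1)[of "Suc j"] by (simp add: Re_q)
    ultimately have "q (Suc j) = cnj (q j)"
      by (auto simp: complex_eq_iff Re_q power2_eq_iff)
    then have "q (Suc j) * q j = 1"
      using q_unit[of j] by (simp add: complex_norm_square[symmetric] mult.commute)
    then have "z (Suc (Suc j)) = z j"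
      by (simp add: z_Suc mult.assoc[symmetric])
    then show False using no_return by blast
  qed
  then have q_const: "q j = q 0" for j
    by (induction j) auto
  show "norm (q 0) = 1" by (rule q_unit)
  have z_rec: "z (Suc j) = z j * q 0" for j
    using z_Suc[of j] q_const[of j] by simp
  show "z j = z 0 * q 0 ^ j" for j
    by (induction j) (simp_all add: z_rec mult_ac)
qed

definition complex_of_vec :: "real^2 \<Rightarrow> complex" where
  "complex_of_vec x = Complex (x $ 1) (x $ 2)"

lemma dist_complex_of_vec: "dist (complex_of_vec x) (complex_of_vec y) = dist x y"
  by (simp add: complex_of_vec_def dist_norm norm_vec_def L2_set_def sum_2 cmod_def)

lemma equilateral_inscribed_polygon_roots:
  fixes A :: "nat \<Rightarrow> real^2"
  assumes n: "n \<ge> 3" and inj: "inj_on A {1..n}" and eq: "equilateral_polygon n A"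
    and C: "\<And>i. i \<in> {1..n} \<Longrightarrow> dist C (A i) = R" and R: "R > 0"
  obtains z w where "norm z = 1" "norm w = 1" "w ^ n = 1" "inj_on (\<lambda>j. w ^ j) {..<n}"
    "\<And>j. j < n \<Longrightarrow> complex_of_vec (A (Suc j)) = complex_of_vec C + of_real R * (z * w ^ j)"
proof -
  \<comment> \<open>Periodic extension with indices starting at 0: the wrap-around in
    \<open>next_vertex\<close> becomes the passage from \<open>j\<close> to
    \<open>Suc j\<close>.\<close>
  define B where "B j = A (Suc (j mod n))" for j
  define z where "z j = (complex_of_vec (B j) - complex_of_vec C) / of_real R" for j
  have idx: "Suc (j mod n) \<in> {1..n}" for j
    using n by (simp add: Suc_leI)
  obtain s where s: "\<And>i. i \<in> {1..n} \<Longrightarrow> dist (A i) (A (next_vertex n i)) = s"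
    using eq unfolding equilateral_polygon_def by blast
  have B_inj: "B i = B j \<longleftrightarrow> i mod n = j mod n" for i j
    unfolding B_def using inj_on_eq_iff[OF inj idx idx] by simp
  have z_diff: "norm (z i - z j) = dist (B i) (B j) / R" for i j
    using R by (simp add: z_def diff_divide_distrib[symmetric] norm_divide
        dist_norm[symmetric] dist_complex_of_vec)
  have z_eq: "z i = z j \<longleftrightarrow> i mod n = j mod n" for i j
    using z_diff[of i j] R B_inj[of i j] by (auto simp flip: B_inj)
  have unit: "norm (z j) = 1" for j
    using C[OF idx, of j] R dist_complex_of_vec[of "B j" C]
    by (simp add: z_def norm_divide B_def dist_norm[symmetric] dist_commute)
  have step: "norm (z (Suc j) - z j) = s / R" for j
    using s[OF idx, of j]
    by (simp add: z_diff B_def next_vertex_def mod_Suc dist_commute split: if_splits)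
  \<comment> \<open>Here \<open>n \<ge> 3\<close> and the distinctness of the vertices enter: a
    return after two steps would make \<open>n\<close> divide 2.\<close>
  have no_return: "z (Suc (Suc j)) \<noteq> z j" for j
  proof
    assume "z (Suc (Suc j)) = z j"
    then have "(j + 2) mod n = j mod n" by (simp add: z_eq)
    then have "n dvd 2" by (simp add: mod_eq_dvd_iff_nat)
    then show False using n by (auto dest: dvd_imp_le)
  qed
  obtain w where w: "norm w = 1" "\<And>j. z j = z 0 * w ^ j"
    using unit_circle_equidistant_power[where z = z and s = "s / R", OF unit step no_return] by blast
  have z0: "z 0 \<noteq> 0" using unit[of 0] by auto
  have "z n = z 0" by (simp add: z_eq)
  then have "w ^ n = 1" using w(2)[of n] z0 by simp
  moreover have "inj_on (\<lambda>j. w ^ j) {..<n}"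
  proof (rule inj_onI)
    fix i j assume "i \<in> {..<n}" "j \<in> {..<n}" "w ^ i = w ^ j"
    then show "i = j" using z_eq[of i j] w(2)[of i] w(2)[of j] by simp
  qed
  moreover have "complex_of_vec (A (Suc j)) = complex_of_vec C + of_real R * (z 0 * w ^ j)"
    if "j < n" for j
    unfolding w(2)[symmetric] using that R by (simp add: z_def B_def)
  ultimately show ?thesis using that unit w(1) by blast
qed

text \<open>Law of cosines in the triangle formed by \<open>M\<close>, the circumcentre and a
  vertex. The numbers \<open>a\<close> and \<open>c\<close> depend on \<open>M\<close> but not on
  \<open>m\<close>, so averages of different orders can be compared.\<close>

lemma cyclic_average_two_Re:
  fixes A :: "nat \<Rightarrow> real^2"
  assumes "n \<ge> 3" "inj_on A {1..n}" "equilateral_polygon n A" "has_circumradius n A R" "R > 0"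
  obtains w c a where "norm w = 1" "w ^ n = 1" "inj_on (\<lambda>j. w ^ j) {..<n}"
    "\<And>m. cyclic_average n A M (2 * m) = (1 / real n) * (\<Sum>j<n. (a + 2 * Re (c * w ^ j)) ^ m)"
proof -
  obtain C where C: "\<And>i. i \<in> {1..n} \<Longrightarrow> dist C (A i) = R"
    using assms(4) unfolding has_circumradius_def by blast
  obtain z w where w: "norm z = 1" "norm w = 1" "w ^ n = 1" "inj_on (\<lambda>j. w ^ j) {..<n}"
    and A: "\<And>j. j < n \<Longrightarrow> complex_of_vec (A (Suc j)) = complex_of_vec C + of_real R * (z * w ^ j)"
    using equilateral_inscribed_polygon_roots[OF assms(1-3) C assms(5)] by blast
  define p where "p = complex_of_vec M - complex_of_vec C"
  define a where "a = (norm p)\<^sup>2 + R\<^sup>2"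
  \<comment> \<open>Chosen to absorb the minus sign of the cross term in the law of cosines.\<close>
  define c where "c = - of_real R * cnj p * z"
  have cosines: "(norm (x - y))\<^sup>2 = (norm x)\<^sup>2 + (norm y)\<^sup>2 - 2 * Re (cnj x * y)" for x y :: complex
    unfolding cmod_power2 by (simp add: power2_eq_square algebra_simps)
  have d: "(dist M (A (Suc j)))\<^sup>2 = a + 2 * Re (c * w ^ j)" if "j < n" for j
  proof -
    have "dist M (A (Suc j)) = norm (p - of_real R * (z * w ^ j))"
      unfolding dist_complex_of_vec[symmetric] by (simp add: A[OF that] p_def dist_norm algebra_simps)
    then have "(dist M (A (Suc j)))\<^sup>2 = (norm p)\<^sup>2 + (norm (of_real R * (z * w ^ j)))\<^sup>2
        - 2 * Re (cnj p * (of_real R * (z * w ^ j)))"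
      by (simp only: cosines)
    moreover have "norm (of_real R * (z * w ^ j)) = R"
      using assms(5) w by (simp add: norm_mult norm_power)
    moreover have "cnj p * (of_real R * (z * w ^ j)) = - (c * w ^ j)"
      by (simp add: c_def mult_ac)
    ultimately show ?thesis by (simp only: a_def) simp
  qed
  have "cyclic_average n A M (2 * m) = (1 / real n) * (\<Sum>j<n. (a + 2 * Re (c * w ^ j)) ^ m)" for m
  proof -
    have "(\<Sum>i=1..n. dist M (A i) ^ (2 * m)) = (\<Sum>j<n. dist M (A (Suc j)) ^ (2 * m))"
      by (rule sum.reindex_bij_witness[where j = "\<lambda>i. i - 1" and i = Suc]) auto
    also have "\<dots> = (\<Sum>j<n. (a + 2 * Re (c * w ^ j)) ^ m)"
      by (simp add: power_mult d)
    finally show ?thesis by (simp add: cyclic_average_def)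
  qed
  then show ?thesis using that w(2-4) by blast
qed

theorem theorem4p2:
  fixes n m :: nat and R :: real and A :: "nat \<Rightarrow> real^2" and M :: "real^2"
  assumes "n \<ge> 3"
    and "regular_polygon n A"
    and "has_circumradius n A R"
    and "R > 0"
    and "3 \<le> m" and "m \<le> n - 1"
  shows "cyclic_average n A M (2 * m) =
      cyclic_average n A M 2 ^ m +
      (\<Sum>k=1..m div 2. 1 / 2 ^ k * real (m choose (2 * k)) * real ((2 * k) choose k) *
         (cyclic_average n A M 4 - (cyclic_average n A M 2)\<^sup>2) ^ k *
         cyclic_average n A M 2 ^ (m - 2 * k))"
proof -
  have "inj_on A {1..n}" "equilateral_polygon n A"
    using assms(2) by (auto simp: regular_polygon_def convex_polygon_def)
  then obtain w c a where w: "norm w = 1" "w ^ n = 1" "inj_on (\<lambda>j. w ^ j) {..<n}"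
    and avg: "\<And>m. cyclic_average n A M (2 * m) = (1 / real n) * (\<Sum>j<n. (a + 2 * Re (c * w ^ j)) ^ m)"
    using cyclic_average_two_Re[where M = M] assms(1,3,4) by metis
  have S: "cyclic_average n A M (2 * l) = (\<Sum>k\<le>l div 2. real (l choose (2 * k)) *
      real ((2 * k) choose k) * ((norm c)\<^sup>2) ^ k * a ^ (l - 2 * k))" if "l < n" for l
    unfolding avg by (rule average_powers_add_two_Re[OF w that])
  have S2: "cyclic_average n A M 2 = a"
    using S[of 1] assms(1) by simp
  \<comment> \<open>The coefficient 2 is \<open>2 choose 1\<close>, from the term
    \<open>k = 1\<close>. It is the source of the factor \<open>1 / 2 ^ k\<close> in the
    theorem.\<close>
  have "cyclic_average n A M 4 = a\<^sup>2 + 2 * (norm c)\<^sup>2"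
    using S[of 2] assms(1) by simp
  then have c: "cyclic_average n A M 4 - (cyclic_average n A M 2)\<^sup>2 = 2 * (norm c)\<^sup>2"
    using S2 by simp
  \<comment> \<open>The term \<open>k = 0\<close> is split off; it is the leading power
    \<open>a ^ m\<close>.\<close>
  have "{..m div 2} = insert 0 {1..m div 2}" by auto
  then have "cyclic_average n A M (2 * m) = a ^ m + (\<Sum>k=1..m div 2. real (m choose (2 * k)) *
      real ((2 * k) choose k) * ((norm c)\<^sup>2) ^ k * a ^ (m - 2 * k))"
    using S[of m] assms(5,6) by simp
  then show ?thesis
    unfolding c unfolding S2 by (simp add: power_mult_distrib mult_ac)
qed

end
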